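(* Let $(X,V,W,S,\mathcal H_*,h,*,\Theta)$ satisfy the abstract symmetrization framework described in the context. Let $(X,\|\cdot\|_V)$ be a Banach space and let $C$ be a closed subset of $S$ such that $v^H\in C$ for all $v\in C$ and $H\in\mathcal H_*$, and $v^*\in C$ for all $v\in C$. Assume that $x\in C$, $y\in S\setminus C$ with $x^H=x$ and $y^H=y$ for any $H\in\mathcal H_*$, and $$\|x-y\|_V\le d(y,C)+\varepsilon^2\qquad\text{for some }\varepsilon>0 .$$ Then there exists a point $\xi_\varepsilon\in\mathrm{Petal}_\varepsilon(x,y)\cap C$ such that $$\mathrm{Petal}_\varepsilon(\xi_\varepsilon,y)\cap C=\{\xi_\varepsilon\}\qquad\text{and}\qquad\|\xi_\varepsilon-\xi_\varepsilon^*\|_V<\varepsilon .$$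
   Context: Abstract framework. $X,V,W$ are real Banach spaces with $X\subseteq V\subseteq W$, $X$ continuously embedded in $V$ and $V$ continuously embedded in $W$; $\|\cdot\|$ is the norm of $X$. $S\subseteq X$ carries the metric induced by $\|\cdot\|$, $\mathcal H_*$ is a path-connected topological space, and there are maps $*:S\to S$, $u\mapsto u^*$ (symmetrization) and $h:S\times\mathcal H_*\to S$, $(u,H)\mapsto u^H$ (polarization) such that: $h$ is continuous; $(u^* )^H=(u^H)^*=u^*$ and $(u^H)^H=u^H$ for all $u\in S$, $H\in\mathcal H_*$; there is a sequence $(H_m)\subset\mathcal H_*$ such that for every $u\in S$ the iterated polarizations $u^{H_1\cdots H_m}$ converge to $u^*$ in $V$ as $m\to\infty$; $\|u^H-v^H\|_V\le\|u-v\|_V$ for all $u,v\in S$, $H\in\mathcal H_*$. Moreover $\Theta:(X,\|\cdot\|_V)\to(S,\|\cdot\|_V)$ is Lipschitz with constant $C_\Theta>0$ and $\Theta|_S=\mathrm{Id}|_S$; for $u\in X$ one sets $u^H:=(\Theta(u))^H$ and $u^*:=(\Theta(u))^*$. In the Banach space $(X,\|\cdot\|_V)$, for $x_0,x_1\in X$ and $\varepsilon>0$, $\mathrm{Petal}_\varepsilon(x_0,x_1):=\{y\in X:\ \varepsilon\|y-x_0\|_V+\|y-x_1\|_V\le\|x_0-x_1\|_V\}$, and $d(y,C)=\inf_{c\in C}\|y-c\|_V$. *)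

theory Defs
  imports "HOL-Analysis.Analysis"
begin

primrec iter_polarization :: "('x \<Rightarrow> 'h \<Rightarrow> 'x) \<Rightarrow> (nat \<Rightarrow> 'h) \<Rightarrow> 'x \<Rightarrow> nat \<Rightarrow> 'x" where
  "iter_polarization pol Hs u 0 = u"
| "iter_polarization pol Hs u (Suc m) = pol (iter_polarization pol Hs u m) (Hs (Suc m))"

text \<open>
  The inclusions of \<open>X\<close> into \<open>V\<close> and of \<open>V\<close> into \<open>W\<close> are injective bounded linear maps
  \<open>\<iota>\<close> and \<open>\<kappa>\<close> between the types \<open>'x\<close>, \<open>'v\<close>, \<open>'w\<close>.  The norm of \<open>X\<close> is that of \<open>'x\<close>, and
  the \<open>V\<close>-norm of \<open>u\<close> in \<open>X\<close> is \<open>norm (\<iota> u)\<close>.  The space of polarizers is the whole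
  type \<open>'h\<close>.  The maps \<open>star\<close> and \<open>pol\<close> are constrained only on \<open>S\<close>.
\<close>

locale symmetrization_framework =
  fixes \<iota> :: "'x::banach \<Rightarrow> 'v::banach"
    and \<kappa> :: "'v \<Rightarrow> 'w::banach"
    and S :: "'x set"
    and star :: "'x \<Rightarrow> 'x"
    and pol :: "'x \<Rightarrow> 'h::topological_space \<Rightarrow> 'x"
    and \<Theta> :: "'x \<Rightarrow> 'x"
  assumes embed_XV: "bounded_linear \<iota>" "inj \<iota>"
    and embed_VW: "bounded_linear \<kappa>" "inj \<kappa>"
    and path_connected_H: "path_connected (UNIV :: 'h set)"
    and star_in: "u \<in> S \<Longrightarrow> star u \<in> S"
    and pol_in: "u \<in> S \<Longrightarrow> pol u H \<in> S"
    and pol_continuous: "continuous_on (S \<times> UNIV) (\<lambda>(u, H). pol u H)"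
    and pol_star: "u \<in> S \<Longrightarrow> pol (star u) H = star u"
    and star_pol: "u \<in> S \<Longrightarrow> star (pol u H) = star u"
    and pol_pol: "u \<in> S \<Longrightarrow> pol (pol u H) H = pol u H"
    and iter_pol_tendsto:
      "\<exists>Hs. \<forall>u\<in>S. (\<lambda>m. \<iota> (iter_polarization pol Hs u m)) \<longlonglongrightarrow> \<iota> (star u)"
    and pol_nonexpansive:
      "u \<in> S \<Longrightarrow> v \<in> S \<Longrightarrow> norm (\<iota> (pol u H - pol v H)) \<le> norm (\<iota> (u - v))"
    and Theta_in: "\<Theta> u \<in> S"
    and Theta_lipschitz:
      "\<exists>C\<^sub>\<Theta>>0. \<forall>u v. norm (\<iota> (\<Theta> u - \<Theta> v)) \<le> C\<^sub>\<Theta> * norm (\<iota> (u - v))"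
    and Theta_id: "u \<in> S \<Longrightarrow> \<Theta> u = u"

definition polarize :: "('x \<Rightarrow> 'x) \<Rightarrow> ('x \<Rightarrow> 'h \<Rightarrow> 'x) \<Rightarrow> 'x \<Rightarrow> 'h \<Rightarrow> 'x" where
  "polarize \<Theta> pol u H = pol (\<Theta> u) H"

definition symmetrize :: "('x \<Rightarrow> 'x) \<Rightarrow> ('x \<Rightarrow> 'x) \<Rightarrow> 'x \<Rightarrow> 'x" where
  "symmetrize \<Theta> star u = star (\<Theta> u)"

definition petal ::
    "('x::real_normed_vector \<Rightarrow> 'v::real_normed_vector) \<Rightarrow> real \<Rightarrow> 'x \<Rightarrow> 'x \<Rightarrow> 'x set" where
  "petal \<iota> \<epsilon> x0 x1 =
    {y. \<epsilon> * norm (\<iota> (y - x0)) + norm (\<iota> (y - x1)) \<le> norm (\<iota> (x0 - x1))}"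

text \<open>This is the distance in the \<open>V\<close>-norm; the infimum is meaningful for nonempty \<open>C\<close>.\<close>

definition V_setdist ::
    "('x::real_normed_vector \<Rightarrow> 'v::real_normed_vector) \<Rightarrow> 'x \<Rightarrow> 'x set \<Rightarrow> real" where
  "V_setdist \<iota> y C = (INF c\<in>C. norm (\<iota> (y - c)))"

end

theory Submission imports Defs begin

text \<open>
  Ekeland's principle (in the form of the petal theorem) is applied not to \<open>C\<close> but to the set \<open>C'\<close>
  of points of \<open>C\<close> fixed by all polarizations, which is closed in the \<open>V\<close>-norm because \<open>X\<close> is
  complete in both norms.  The limit of iterated polarizations is nonexpansive towards every fixed
  point, so symmetrization maps \<open>petal \<iota> \<epsilon> \<xi> y \<inter> C\<close> into \<open>petal \<iota> \<epsilon> \<xi> y \<inter> C'\<close> when \<open>\<xi>\<close> and \<open>y\<close>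
  are fixed.  Hence minimality of \<open>\<xi>\<close> in \<open>C'\<close> implies minimality in \<open>C\<close>, and \<open>\<xi>\<close> is its own
  symmetrization.
\<close>

section \<open>Ekeland's variational principle on a closed set\<close>

text \<open>Descend from \<open>x\<close> along the order "w below u iff \<epsilon> dist w u + f w
  \<le> f u", choosing almost minimal values of \<open>f\<close>. The sets of points below the
  chosen ones are nested, closed and of shrinking diameter, so Cantor's intersection theorem yields
  a common point, and that point is minimal.\<close>

lemma ekeland_variational_principle:
  fixes f :: "'a::complete_space \<Rightarrow> real"
  assumes D: "closed D" "x \<in> D" and f: "continuous_on D f" "bdd_below (f ` D)" and e: "\<epsilon> > 0"
  obtains \<xi> where "\<xi> \<in> D" "\<epsilon> * dist \<xi> x + f \<xi> \<le> f x"
    "\<And>w. w \<in> D \<Longrightarrow> \<epsilon> * dist w \<xi> + f w \<le> f \<xi> \<Longrightarrow> w = \<xi>"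
proof -
  define P where "P u = {w \<in> D. \<epsilon> * dist w u + f w \<le> f u}" for u
  have P_self: "u \<in> P u" if "u \<in> D" for u
    using that by (simp add: P_def)
  have P_trans: "P w \<subseteq> P u" if "w \<in> P u" for u w
  proof
    fix z assume z: "z \<in> P w"
    have "\<epsilon> * dist z u \<le> \<epsilon> * dist z w + \<epsilon> * dist w u"
      using e dist_triangle[of z u w] by (simp flip: distrib_left)
    then show "z \<in> P u"
      using z that by (auto simp: P_def)
  qed
  have P_closed: "closed (P u)" for u
  proof -
    have "continuous_on D (\<lambda>w. \<epsilon> * dist w u + f w)"
      by (intro continuous_intros f)
    from continuous_closed_preimage[OF this D(1), of "{..f u}"] show ?thesis
      by (simp add: P_def vimage_def Int_def)
  qed
  have P_bdd: "bdd_below (f ` P u)" for u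
    using f(2) by (rule bdd_below_mono) (auto simp: P_def)
  have step: "\<exists>v. v \<in> P u \<and> f v < Inf (f ` P u) + (1/2)^n" if "u \<in> D" for u and n :: nat
  proof -
    have "\<exists>a \<in> f ` P u. a < Inf (f ` P u) + (1/2)^n"
      using P_self[OF that] P_bdd[of u] by (intro cInf_lessD) auto
    then show ?thesis by blast
  qed
  \<comment> \<open>The clause for \<open>n = 0\<close> pins the start of the sequence to
    \<open>x\<close>, so that the limit point ends up in \<open>P x\<close>.\<close>
  have "\<exists>u. \<forall>n. (u n \<in> D \<and> (n = 0 \<longrightarrow> u n = x)) \<and>
      (u (Suc n) \<in> P (u n) \<and> f (u (Suc n)) < Inf (f ` P (u n)) + (1/2)^n)"
  proof (rule dependent_nat_choice)
    show "\<exists>v. v \<in> D \<and> (0 = 0 \<longrightarrow> v = x)"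
      using D(2) by blast
    fix v :: 'a and n :: nat
    assume "v \<in> D \<and> (n = 0 \<longrightarrow> v = x)"
    then show "\<exists>w. (w \<in> D \<and> (Suc n = 0 \<longrightarrow> w = x)) \<and>
        (w \<in> P v \<and> f w < Inf (f ` P v) + (1/2)^n)"
      using step[of v n] by (auto simp: P_def)
  qed
  then obtain u where uD: "\<And>n. u n \<in> D" and u0: "u 0 = x"
    and uS: "\<And>n. u (Suc n) \<in> P (u n)"
    and uI: "\<And>n. f (u (Suc n)) < Inf (f ` P (u n)) + (1/2)^n"
    by blast
  have anti: "P (u n) \<subseteq> P (u m)" if "m \<le> n" for m n
    using that by (rule lift_Suc_antimono_le[rotated]) (rule P_trans[OF uS])
  \<comment> \<open>Any \<open>w\<close> below \<open>u (Suc n)\<close> is also below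
    \<open>u n\<close>, so \<open>f w\<close> is at least the infimum that
    \<open>f (u (Suc n))\<close> misses by less than (1/2)^n; this possible decrease of
    \<open>f\<close> bounds \<epsilon> times the distance.\<close>
  have near: "dist w (u (Suc n)) \<le> (1/2)^n / \<epsilon>" if "w \<in> P (u (Suc n))" for w n
  proof -
    have "w \<in> P (u n)"
      using that anti[of n "Suc n"] by auto
    then have "Inf (f ` P (u n)) \<le> f w"
      using P_bdd by (intro cInf_lower) auto
    then have "\<epsilon> * dist w (u (Suc n)) \<le> (1/2)^n"
      using that uI[of n] by (simp add: P_def)
    then show ?thesis
      using e by (simp add: field_simps)
  qed
  have small: "\<exists>n. \<forall>v\<in>P (u n). \<forall>w\<in>P (u n). dist v w < r" if "r > 0" for r
  proof -
    obtain n :: nat where n: "(1/2)^n < \<epsilon> * r / 2"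
      using real_arch_pow_inv[of "\<epsilon> * r / 2" "1/2"] e \<open>r > 0\<close> by auto
    have "dist v w < r" if "v \<in> P (u (Suc n))" "w \<in> P (u (Suc n))" for v w
    proof -
      have "dist v w \<le> (1/2)^n / \<epsilon> + (1/2)^n / \<epsilon>"
        using near[OF that(1)] near[OF that(2)] dist_triangle2[of v w "u (Suc n)"] by linarith
      also have "\<dots> < r"
        using n e by (simp add: field_simps)
      finally show ?thesis .
    qed
    then show ?thesis by blast
  qed
  obtain \<xi> where \<xi>: "\<And>n. \<xi> \<in> P (u n)"
    using decreasing_closed_nest[of "\<lambda>n. P (u n)"] P_closed P_self uD anti small by (metis empty_iff)
  show thesis
  proof
    show "\<xi> \<in> D" "\<epsilon> * dist \<xi> x + f \<xi> \<le> f x"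
      using \<xi>[of 0] by (auto simp: P_def u0)
    \<comment> \<open>By transitivity \<open>w\<close> joins \<xi> in every \<open>P (u n)\<close>,
      and these sets have arbitrarily small diameter.\<close>
    fix w assume "w \<in> D" "\<epsilon> * dist w \<xi> + f w \<le> f \<xi>"
    then have "w \<in> P (u n)" for n
      using P_trans[OF \<xi>[of n]] by (auto simp: P_def)
    then have "dist w \<xi> < r" if "r > 0" for r
      using small[OF that] \<xi> by blast
    then show "w = \<xi>"
      by (metis dist_eq_0_iff less_irrefl zero_less_dist_iff)
  qed
qed

section \<open>Equivalence of the two norms: bounded inverses and closed images\<close>

text \<open>The Baire half of the open mapping theorem: the closures of the images of balls cover
  the complete range, so one of them contains a relative ball. A direction \<open>z\<close> is then
  the scaled difference of two points of that ball, each approximated by images of vectors of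
  bounded norm.\<close>

lemma bounded_linear_approx_preimage:
  fixes f :: "'a::real_normed_vector \<Rightarrow> 'b::banach"
  assumes f: "bounded_linear f" and range: "complete (range f)"
  obtains K where "K > 0"
    "\<And>z. z \<in> range f \<Longrightarrow> \<exists>x. norm x \<le> K * norm z \<and> norm (z - f x) \<le> norm z / 2"
proof -
  interpret f: bounded_linear f by fact
  have cl: "closed (range f)"
    using range by (rule complete_imp_closed)
  define F where "F n = closure (f ` cball 0 (real n))" for n :: nat
  have F_sub: "F n \<subseteq> range f" for n
    unfolding F_def using cl by (intro closure_minimal) auto
  have F_closedin: "closedin (top_of_set (range f)) (F n)" for n
    using F_sub by (intro closed_subset) (auto simp: F_def)
  have "range f \<subseteq> \<Union>(range F)"
  proof clarify
    fix x :: 'a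
    obtain n where "norm x \<le> real n"
      using real_arch_simple by blast
    then have "f x \<in> F n"
      unfolding F_def by (intro subsetD[OF closure_subset]) auto
    then show "f x \<in> \<Union>(range F)" by blast
  qed
  then have UF: "\<Union>(range F) = range f"
    using F_sub by blast
  have "\<exists>n. (top_of_set (range f)) interior_of (F n) \<noteq> {}"
  proof (rule ccontr)
    assume "\<not> ?thesis"
    then have empty: "(top_of_set (range f)) interior_of (F n) = {}" for n
      by blast
    have "completely_metrizable_space (top_of_set (range f))"
      by (rule completely_metrizable_space_closedin[OF completely_metrizable_space_euclidean])
        (use cl in \<open>simp flip: closed_closedin\<close>)
    then have "(top_of_set (range f)) interior_of \<Union>(range F) = {}"
      by (intro Baire_category_alt disjI1 countable_image countableI_type)
        (use F_closedin empty in blast)+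
    then show False
      using UF interior_of_topspace[of "top_of_set (range f)"] by simp
  qed
  then obtain n y0 where "y0 \<in> (top_of_set (range f)) interior_of (F n)"
    by blast
  then obtain T where T: "openin (top_of_set (range f)) T" "y0 \<in> T" "T \<subseteq> F n"
    unfolding interior_of_def by auto
  then obtain r where r: "r > 0" "ball y0 r \<inter> range f \<subseteq> F n"
    unfolding openin_contains_ball by blast
  have y0: "y0 \<in> F n" "y0 \<in> range f"
    using T F_sub by blast+
  show thesis
  proof
    \<comment> \<open>The estimate below gives 2n/c = 4n * \<open>norm z\<close> / r; the extra 1
      keeps the constant positive when n = 0.\<close>
    show "4 * (real n + 1) / r > 0"
      using r by simp
    fix z assume z: "z \<in> range f"
    show "\<exists>x. norm x \<le> 4 * (real n + 1) / r * norm z \<and> norm (z - f x) \<le> norm z / 2"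
    proof (cases "z = 0")
      case True
      then show ?thesis by (intro exI[of _ 0]) (simp add: f.zero)
    next
      case False
      \<comment> \<open>This scaling gives \<open>c *\<^sub>R z\<close> length r/2, which keeps
        \<open>y0 + c *\<^sub>R z\<close> inside the ball.\<close>
      define c where "c = r / (2 * norm z)"
      have c: "c > 0" "c * norm z = r / 2"
        using r False by (auto simp: c_def)
      \<comment> \<open>Two approximation errors of size \<open>e\<close>, divided by
        \<open>c\<close>, add up to \<open>norm z / 2\<close>.\<close>
      define e where "e = c * norm z / 4"
      have e: "e > 0"
        using c r by (simp add: e_def)
      have "y0 + c *\<^sub>R z \<in> range f"
      proof -
        obtain a b where "y0 = f a" "z = f b"
          using y0 z by blast
        then have "y0 + c *\<^sub>R z = f (a + c *\<^sub>R b)"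
          by (simp add: f.add f.scale)
        then show ?thesis by blast
      qed
      moreover have "y0 + c *\<^sub>R z \<in> ball y0 r"
        using c r by (simp add: dist_norm)
      ultimately have "y0 + c *\<^sub>R z \<in> F n"
        using r by blast
      then obtain v where v: "norm v \<le> n" "dist (f v) (y0 + c *\<^sub>R z) < e"
        unfolding F_def using e by (auto simp: closure_approachable)
      obtain w where w: "norm w \<le> n" "dist (f w) y0 < e"
        using y0(1) e unfolding F_def by (auto simp: closure_approachable)
      define x where "x = (1/c) *\<^sub>R (v - w)"
      have "norm (v - w) \<le> 2 * real n"
        using v(1) w(1) norm_triangle_ineq4[of v w] by linarith
      then have "norm x \<le> (2 * real n) / c"
        using c(1) by (simp add: x_def divide_right_mono)
      also have "\<dots> \<le> 4 * (real n + 1) / r * norm z"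
        using r False by (simp add: c_def field_simps)
      finally have nx: "norm x \<le> 4 * (real n + 1) / r * norm z" .
      have "z - f x = (1/c) *\<^sub>R ((y0 + c *\<^sub>R z - f v) - (y0 - f w))"
        using c(1) by (simp add: x_def f.scale f.diff algebra_simps)
      moreover have "norm ((y0 + c *\<^sub>R z - f v) - (y0 - f w)) \<le> e + e"
        using v(2) w(2) norm_triangle_ineq4[of "y0 + c *\<^sub>R z - f v" "y0 - f w"]
        by (simp add: dist_norm norm_minus_commute)
      ultimately have "norm (z - f x) \<le> (1/c) * (e + e)"
        using c(1) by (simp add: divide_right_mono)
      also have "\<dots> = norm z / 2"
        using c(1) by (simp add: e_def)
      finally show ?thesis
        using nx by blast
    qed
  qed
qed

text \<open>Successive approximation: correcting by approximate preimages halves the residual each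
  time, so the corrections form an absolutely convergent series. Its sum has image
  \<open>f x\<close>, hence equals \<open>x\<close> by injectivity, and the geometric series bounds
  its norm.\<close>

theorem bounded_inverse:
  fixes f :: "'a::banach \<Rightarrow> 'b::banach"
  assumes f: "bounded_linear f" and inj: "inj f" and range: "complete (range f)"
  obtains B where "B > 0" "\<And>x. norm x \<le> B * norm (f x)"
proof -
  interpret f: bounded_linear f by fact
  obtain K where K: "K > 0" and
    ex: "\<And>z. z \<in> range f \<Longrightarrow> \<exists>x. norm x \<le> K * norm z \<and> norm (z - f x) \<le> norm z / 2"
    using bounded_linear_approx_preimage[OF f range] by metis
  obtain g where g: "\<And>z. z \<in> range f \<Longrightarrow> norm (g z) \<le> K * norm z"
    "\<And>z. z \<in> range f \<Longrightarrow> norm (z - f (g z)) \<le> norm z / 2"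
    using ex by metis
  show thesis
  proof
    show "2 * K > 0"
      using K by simp
    fix x
    \<comment> \<open>\<open>z n\<close> is the part of \<open>f x\<close> still without a preimage
      after n corrections.\<close>
    define z where "z n = ((\<lambda>z. z - f (g z)) ^^ n) (f x)" for n
    have z0: "z 0 = f x" and zS: "z (Suc n) = z n - f (g (z n))" for n
      by (simp_all add: z_def)
    have z_range: "z n \<in> range f" for n
    proof (induction n)
      case (Suc n)
      then obtain a where "z n = f a" by blast
      then have "z (Suc n) = f (a - g (z n))"
        by (simp add: zS f.diff)
      then show ?case by blast
    qed (simp add: z0)
    have z_norm: "norm (z n) \<le> norm (f x) * (1/2)^n" for n
    proof (induction n)
      case (Suc n)
      then show ?case
        using g(2)[OF z_range[of n]] by (simp add: zS)
    qed (simp add: z0)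
    have g_norm: "norm (g (z n)) \<le> K * norm (f x) * (1/2)^n" for n
      using order_trans[OF g(1)[OF z_range[of n]] mult_left_mono[OF z_norm[of n]]] K
      by (simp add: mult.assoc)
    have geom: "(\<lambda>n. K * norm (f x) * (1/2)^n) sums (2 * K * norm (f x))"
      using sums_mult[OF geometric_sums[of "1/2::real"], of "K * norm (f x)"] by (simp add: mult_ac)
    have sn: "summable (\<lambda>n. norm (g (z n)))"
      using g_norm geom by (intro summable_comparison_test[OF _ sums_summable[OF geom]]) auto
    have "(\<lambda>n. norm (f x) * (1/2)^n) \<longlonglongrightarrow> norm (f x) * 0"
      by (intro tendsto_mult tendsto_const LIMSEQ_power_zero) simp
    then have "z \<longlonglongrightarrow> 0"
      using z_norm by (intro Lim_null_comparison[of z]) auto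
    then have "(\<lambda>n. z n - z (Suc n)) sums (z 0 - 0)"
      by (rule telescope_sums')
    then have "(\<lambda>n. f (g (z n))) sums f x"
      by (simp add: zS z0)
    moreover have "(\<lambda>n. f (g (z n))) sums f (\<Sum>n. g (z n))"
      by (rule f.sums[OF summable_sums[OF summable_norm_cancel[OF sn]]])
    ultimately have "f x = f (\<Sum>n. g (z n))"
      by (rule sums_unique2)
    then have "x = (\<Sum>n. g (z n))"
      using inj by (simp add: inj_eq)
    then have "norm x \<le> (\<Sum>n. norm (g (z n)))"
      using summable_norm[OF sn] by simp
    also have "\<dots> \<le> 2 * K * norm (f x)"
      using suminf_le[OF g_norm sn sums_summable[OF geom]] sums_unique[OF geom] by simp
    finally show "norm x \<le> 2 * K * norm (f x)" .
  qed
qed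

text \<open>The lower bound on \<open>f\<close> turns a convergent sequence of images into a Cauchy
  sequence of preimages.\<close>

lemma closed_image_of_bounded_below:
  fixes f :: "'a::banach \<Rightarrow> 'b::real_normed_vector"
  assumes f: "bounded_linear f" and B: "B > 0" "\<And>x. norm x \<le> B * norm (f x)" and D: "closed D"
  shows "closed (f ` D)"
proof -
  interpret f: bounded_linear f by fact
  show ?thesis
    unfolding closed_sequential_limits
  proof safe
    fix s l assume s: "\<forall>n. s n \<in> f ` D" and l: "s \<longlonglongrightarrow> l"
    obtain c where c: "\<And>n. c n \<in> D" "\<And>n. s n = f (c n)"
      using s unfolding image_iff by metis
    have "Cauchy c"
    proof (rule metric_CauchyI)
      fix e :: real assume "e > 0"
      then obtain N where N: "\<And>m n. m \<ge> N \<Longrightarrow> n \<ge> N \<Longrightarrow> dist (s m) (s n) < e / B"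
        using metric_CauchyD[OF LIMSEQ_imp_Cauchy[OF l], of "e / B"] B(1) divide_pos_pos by blast
      have "dist (c m) (c n) < e" if "m \<ge> N" "n \<ge> N" for m n
      proof -
        have "dist (c m) (c n) \<le> B * dist (s m) (s n)"
          using B(2)[of "c m - c n"] by (simp add: dist_norm c f.diff)
        also have "\<dots> < e"
          using N[OF that] B(1) by (simp add: field_simps)
        finally show ?thesis .
      qed
      then show "\<exists>N. \<forall>m\<ge>N. \<forall>n\<ge>N. dist (c m) (c n) < e" by blast
    qed
    then obtain a where a: "c \<longlonglongrightarrow> a"
      using Cauchy_convergent convergent_def by blast
    then have "a \<in> D"
      using D c(1) closed_sequentially by blast
    moreover have "s \<longlonglongrightarrow> f a"
      using f.tendsto[OF a] by (simp flip: c(2))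
    then have "l = f a"
      using l LIMSEQ_unique by blast
    ultimately show "l \<in> f ` D" by blast
  qed
qed

section \<open>Nonexpansiveness of symmetrization, and closedness of \<open>S\<close> and of the
  polarization-fixed points\<close>

context symmetrization_framework
begin

sublocale \<iota>: bounded_linear \<iota>
  by (rule embed_XV)

lemma iter_polarization_in: "u \<in> S \<Longrightarrow> iter_polarization pol Hs u m \<in> S"
  by (induction m) (auto intro: pol_in)

lemma iter_polarization_nonexpansive:
  assumes "u \<in> S" "v \<in> S" "\<And>H. pol v H = v"
  shows "norm (\<iota> (iter_polarization pol Hs u m - v)) \<le> norm (\<iota> (u - v))"
proof (induction m)
  case (Suc m)
  then show ?case
    using pol_nonexpansive[OF iter_polarization_in[OF assms(1)] assms(2), of Hs m "Hs (Suc m)"]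
      assms(3) by simp
qed simp

text \<open>Each polarization fixes \<open>v\<close>, so no iterate of \<open>u\<close> moves away
  from \<open>v\<close>; the bound survives the limit because the iterates converge in the norm of
  V.\<close>

lemma star_nonexpansive:
  assumes "u \<in> S" "v \<in> S" "\<And>H. pol v H = v"
  shows "norm (\<iota> (star u - v)) \<le> norm (\<iota> (u - v))"
proof -
  obtain Hs where "(\<lambda>m. \<iota> (iter_polarization pol Hs u m)) \<longlonglongrightarrow> \<iota> (star u)"
    using iter_pol_tendsto assms(1) by blast
  then have "(\<lambda>m. norm (\<iota> (iter_polarization pol Hs u m - v))) \<longlonglongrightarrow> norm (\<iota> (star u - v))"
    unfolding \<iota>.diff by (intro tendsto_intros)
  then show ?thesis
    by (rule Lim_bounded) (use iter_polarization_nonexpansive[OF assms] in blast)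
qed

lemma star_fixed:
  assumes "v \<in> S" "\<And>H. pol v H = v"
  shows "star v = v"
  using star_nonexpansive[OF assms(1) assms] embed_XV(2)
  by (simp add: \<iota>.zero \<iota>.diff inj_eq)

text \<open>\<open>\<Theta>\<close> is a retraction onto \<open>S\<close> that is continuous in the
  V-norm, so a limit of points of \<open>S\<close> is fixed by \<open>\<Theta>\<close> and thus lies
  in its range.\<close>

lemma limit_in_S:
  assumes "c \<longlonglongrightarrow> a" "\<And>n. c n \<in> S"
  shows "a \<in> S"
proof -
  obtain L where L: "\<And>u v. norm (\<iota> (\<Theta> u - \<Theta> v)) \<le> L * norm (\<iota> (u - v))"
    using Theta_lipschitz by blast
  have lim: "(\<lambda>n. \<iota> (c n)) \<longlonglongrightarrow> \<iota> a"
    by (intro \<iota>.tendsto assms)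
  have "(\<lambda>n. \<iota> (c n) - \<iota> (\<Theta> a)) \<longlonglongrightarrow> 0"
  proof (rule Lim_null_comparison)
    show "\<forall>\<^sub>F n in sequentially. norm (\<iota> (c n) - \<iota> (\<Theta> a)) \<le> L * norm (\<iota> (c n) - \<iota> a)"
      using L[of "c _" a] by (simp add: Theta_id assms(2) \<iota>.diff)
    show "(\<lambda>n. L * norm (\<iota> (c n) - \<iota> a)) \<longlonglongrightarrow> 0"
      using lim by (intro tendsto_mult_right_zero tendsto_norm_zero) (simp add: LIM_zero)
  qed
  then have "(\<lambda>n. \<iota> (c n)) \<longlonglongrightarrow> \<iota> (\<Theta> a)"
    by (rule LIM_zero_cancel)
  then have "\<Theta> a = a"
    using LIMSEQ_unique[OF lim] embed_XV(2) by (metis inj_eq)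
  then show ?thesis
    using Theta_in[of a] by simp
qed

lemma closed_S: "closed S"
  unfolding closed_sequential_limits using limit_in_S by blast

text \<open>Nonexpansiveness forces \<open>c n = pol (c n) H\<close> to converge in V to
  \<open>pol a H\<close> as well as to \<open>a\<close>; injectivity of \<iota> identifies the two
  limits.\<close>

lemma closed_polarization_fixed: "closed {v \<in> S. \<forall>H. pol v H = v}"
  unfolding closed_sequential_limits
proof clarify
  fix c a assume c: "\<forall>n. c n \<in> {v \<in> S. \<forall>H. pol v H = v}" and a: "c \<longlonglongrightarrow> a"
  have aS: "a \<in> S"
    using c a closed_S closed_sequentially by blast
  have "pol a H = a" for H
  proof -
    have lim: "(\<lambda>n. \<iota> (c n)) \<longlonglongrightarrow> \<iota> a"
      by (intro \<iota>.tendsto a)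
    have "(\<lambda>n. \<iota> (c n) - \<iota> (pol a H)) \<longlonglongrightarrow> 0"
    proof (rule Lim_null_comparison)
      show "\<forall>\<^sub>F n in sequentially. norm (\<iota> (c n) - \<iota> (pol a H)) \<le> norm (\<iota> (c n) - \<iota> a)"
        using pol_nonexpansive[of "c _" a H] c aS by (simp add: \<iota>.diff)
      show "(\<lambda>n. norm (\<iota> (c n) - \<iota> a)) \<longlonglongrightarrow> 0"
        using lim by (intro tendsto_norm_zero) (simp add: LIM_zero)
    qed
    then have "(\<lambda>n. \<iota> (c n)) \<longlonglongrightarrow> \<iota> (pol a H)"
      by (rule LIM_zero_cancel)
    then show ?thesis
      using LIMSEQ_unique[OF lim] embed_XV(2) by (metis inj_eq)
  qed
  then show "a \<in> S \<and> (\<forall>H. pol a H = a)"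
    using aS by blast
qed

end

section \<open>The minimal petal\<close>

theorem theorem3p12:
  fixes \<iota> :: "'x::banach \<Rightarrow> 'v::banach"
    and \<kappa> :: "'v \<Rightarrow> 'w::banach"
    and S C :: "'x set"
    and star :: "'x \<Rightarrow> 'x"
    and pol :: "'x \<Rightarrow> 'h::topological_space \<Rightarrow> 'x"
    and \<Theta> :: "'x \<Rightarrow> 'x"
    and x y :: 'x
    and \<epsilon> :: real
  assumes framework: "symmetrization_framework \<iota> \<kappa> S star pol \<Theta>"
    and banach_V_norm: "complete (range \<iota>)"
    and C_closed: "closedin (top_of_set S) C"
    and C_pol: "\<And>v H. v \<in> C \<Longrightarrow> polarize \<Theta> pol v H \<in> C"
    and C_star: "\<And>v. v \<in> C \<Longrightarrow> symmetrize \<Theta> star v \<in> C"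
    and x: "x \<in> C" "\<And>H. polarize \<Theta> pol x H = x"
    and y: "y \<in> S - C" "\<And>H. polarize \<Theta> pol y H = y"
    and eps: "\<epsilon> > 0"
    and near: "norm (\<iota> (x - y)) \<le> V_setdist \<iota> y C + \<epsilon>\<^sup>2"
  shows "\<exists>\<xi> \<in> petal \<iota> \<epsilon> x y \<inter> C.
    petal \<iota> \<epsilon> \<xi> y \<inter> C = {\<xi>} \<and> norm (\<iota> (\<xi> - symmetrize \<Theta> star \<xi>)) < \<epsilon>"
proof -
  interpret symmetrization_framework \<iota> \<kappa> S star pol \<Theta> by fact
  have CS: "C \<subseteq> S" and C_cl: "closed C"
    using C_closed closed_S closedin_imp_subset closedin_closed_trans by blast+
  define D where "D = C \<inter> {v \<in> S. \<forall>H. pol v H = v}"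
  have D_cl: "closed D"
    unfolding D_def by (intro closed_Int C_cl closed_polarization_fixed)
  have star_D: "star w \<in> D" if "w \<in> C" for w
    using that CS C_star[OF that] by (auto simp: D_def symmetrize_def Theta_id star_in pol_star)
  have xD: "x \<in> D"
    using x CS by (auto simp: D_def polarize_def Theta_id)
  have yS: "y \<in> S" and y_fix: "\<And>H. pol y H = y"
    using y by (auto simp: polarize_def Theta_id)
  obtain B where B: "B > 0" "\<And>u. norm u \<le> B * norm (\<iota> u)"
    using bounded_inverse[OF embed_XV banach_V_norm] by blast
  have im_cl: "closed (\<iota> ` D)"
    by (rule closed_image_of_bounded_below[OF embed_XV(1) B D_cl])
  have dist_\<iota>: "dist (\<iota> a) (\<iota> b) = norm (\<iota> (a - b))" for a b
    by (simp add: dist_norm \<iota>.diff)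
  \<comment> \<open>Ekeland is applied in V to the distance to \<open>\<iota> y\<close>, for which
    the order relation is exactly membership in a petal with tip \<open>y\<close>.\<close>
  obtain \<xi>' where \<xi>': "\<xi>' \<in> \<iota> ` D" "\<epsilon> * dist \<xi>' (\<iota> x) + dist \<xi>' (\<iota> y) \<le> dist (\<iota> x) (\<iota> y)"
    "\<And>w. w \<in> \<iota> ` D \<Longrightarrow> \<epsilon> * dist w \<xi>' + dist w (\<iota> y) \<le> dist \<xi>' (\<iota> y) \<Longrightarrow> w = \<xi>'"
  proof (rule ekeland_variational_principle[OF im_cl imageI[OF xD], of "\<lambda>v. dist v (\<iota> y)" \<epsilon>])
    show "continuous_on (\<iota> ` D) (\<lambda>v. dist v (\<iota> y))"
      by (intro continuous_intros)
    show "bdd_below ((\<lambda>v. dist v (\<iota> y)) ` \<iota> ` D)"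
      by (rule bdd_belowI[of _ 0]) auto
  qed (use eps in auto)
  then obtain \<xi> where \<xi>: "\<xi> \<in> D" "\<xi>' = \<iota> \<xi>" by blast
  have \<xi>_C: "\<xi> \<in> C" and \<xi>_S: "\<xi> \<in> S" and \<xi>_fix: "\<And>H. pol \<xi> H = \<xi>"
    using \<xi>(1) by (auto simp: D_def)
  have \<xi>_petal: "\<xi> \<in> petal \<iota> \<epsilon> x y"
    using \<xi>'(2) by (simp add: petal_def \<xi>(2) dist_\<iota>)
  have \<xi>_min: "w = \<xi>" if "w \<in> D" "w \<in> petal \<iota> \<epsilon> \<xi> y" for w
    using that \<xi>'(3)[of "\<iota> w"] embed_XV(2) by (simp add: petal_def \<xi>(2) dist_\<iota> inj_eq)
  have only: "w = \<xi>" if w: "w \<in> C" "w \<in> petal \<iota> \<epsilon> \<xi> y" for w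
  proof -
    have wS: "w \<in> S" using w CS by blast
    have "\<epsilon> * norm (\<iota> (star w - \<xi>)) \<le> \<epsilon> * norm (\<iota> (w - \<xi>))"
      using eps star_nonexpansive[OF wS \<xi>_S \<xi>_fix] by simp
    then have "star w \<in> petal \<iota> \<epsilon> \<xi> y"
      using w(2) star_nonexpansive[OF wS yS y_fix] by (simp add: petal_def)
    then have "star w = \<xi>"
      using \<xi>_min star_D[OF w(1)] by blast
    \<comment> \<open>Since \<open>star w\<close> is \<xi>, the point \<open>w\<close> is no closer
      to \<open>y\<close> than \<xi> is, which leaves no room for a positive \<epsilon>-term in the
      petal inequality.\<close>
    then have "norm (\<iota> (\<xi> - y)) \<le> norm (\<iota> (w - y))"
      using star_nonexpansive[OF wS yS y_fix] by simp
    then have "\<epsilon> * norm (\<iota> (w - \<xi>)) \<le> 0"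
      using w(2) by (simp add: petal_def)
    then have "norm (\<iota> (w - \<xi>)) \<le> 0"
      using eps by (simp add: mult_le_0_iff)
    then show ?thesis
      using embed_XV(2) by (simp add: \<iota>.diff inj_eq)
  qed
  have "\<xi> \<in> petal \<iota> \<epsilon> \<xi> y"
    by (simp add: petal_def \<iota>.zero)
  then have "petal \<iota> \<epsilon> \<xi> y \<inter> C = {\<xi>}"
    using only \<xi>_C by blast
  \<comment> \<open>The required bound by \<epsilon> thus holds with left-hand side 0.\<close>
  moreover have "symmetrize \<Theta> star \<xi> = \<xi>"
    by (simp add: symmetrize_def Theta_id \<xi>_S star_fixed \<xi>_fix)
  ultimately show ?thesis
    using \<xi>_petal \<xi>_C eps by (intro bexI[of _ \<xi>]) (simp_all add: \<iota>.zero)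
qed

end
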